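(* Let $u^k$ be the $k$-th iterate of the FASD algorithm (fast subspace descent with exact line search, described in the context) and $u^{k+1}={\rm FASD}(u^k)$. Suppose that the space decomposition $\mathcal V=\mathcal V_1+\cdots+\mathcal V_N$ is stable with constant $C_A$ and satisfies the strengthened Cauchy--Schwarz inequality with constant $C_S$, that $E$ is strongly convex with constant $\mu$ and has Lipschitz continuous derivative on $\mathcal B$ with constant $L$, and that each local energy $E_i$ is strongly convex with constant $\mu_i$ and has Lipschitz continuous derivative on $\mathcal B_i$ with constant $L_i$ (all in the sense given in the context). Let $u$ be the minimizer of $E$ over $\mathcal V$. Then $$E(u^{k+1})-E(u)\le \rho\,\bigl(E(u^k)-E(u)\bigr),\qquad \rho=\frac{C_A^2\left[C_S+L\left(1+\max_{1\le i\le N}\{L_i/\mu_i\}\right)\right]^2}{C_A^2\left[C_S+L\left(1+\max_{1\le i\le N}\{L_i/\mu_i\}\right)\right]^2+\mu^2}.$$ Furthermore, if at each subspace step the local energy is the quadratic $E_i(w)=\tfrac12\|w-Q_iv_{i-1}\|_{\mathcal V}^2$, $w\in\mathcal V_i$, then the same estimate holds with $$\rho=\frac{C_A^2(C_S+2L)^2}{C_A^2(C_S+2L)^2+\mu^2}.$$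
   Context: $\mathcal V$ is a real Hilbert space with norm $\|\cdot\|_{\mathcal V}$, dual $\mathcal V'$, duality pairing $\langle\cdot,\cdot\rangle$, and dual norm $\|f\|_{\mathcal V'}=\sup_{v\neq0}\langle f,v\rangle/\|v\|_{\mathcal V}$. $E:\mathcal V\to\mathbb R$ is Fréchet differentiable with derivative $E'(v)\in\mathcal V'$. A point $u_0\in\mathcal V$ is fixed, $\mathcal B=\{v\in\mathcal V: E(v)\le E(u_0)\}$, and the iteration starts from $u^0=u_0$. Strong convexity of $E$: there is $\mu>0$ with $\mu\|w-v\|_{\mathcal V}^2\le\langle E'(w)-E'(v),w-v\rangle$ for all $v,w\in\mathcal V$ (then $E$ has a unique global minimizer $u$). Lipschitz derivative of $E$: there is $L$ with $\|E'(w)-E'(v)\|_{\mathcal V'}\le L\|w-v\|_{\mathcal V}$ for all $v,w\in\mathcal B$. Space decomposition: $\mathcal V=\mathcal V_1+\cdots+\mathcal V_N$ with closed subspaces $\mathcal V_i\subseteq\mathcal V$. Stable decomposition: there is $C_A>0$ such that each $v\in\mathcal V$ can be written $v=\sum_{i=1}^Nv_i$, $v_i\in\mathcal V_i$, with $\sum_{i=1}^N\|v_i\|_{\mathcal V}^2\le C_A^2\|v\|_{\mathcal V}^2$. Strengthened Cauchy--Schwarz inequality: there is $C_S>0$ such that for any $w_{i,j}\in\mathcal B$, $u_j\in\mathcal V_j$, $v_i\in\mathcal V_i$ with $w_{i,j}+u_j\in\mathcal B$, $$\sum_{i=1}^N\sum_{j=i+1}^N\langle E'(w_{i,j}+u_j)-E'(w_{i,j}),v_i\rangle\le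 C_S\Bigl(\sum_{i=1}^N\|u_i\|_{\mathcal V}^2\Bigr)^{1/2}\Bigl(\sum_{i=1}^N\|v_i\|_{\mathcal V}^2\Bigr)^{1/2}.$$ Local objects: $R_i:\mathcal V'\to\mathcal V_i'$ is restriction of functionals to $\mathcal V_i$; $Q_i:\mathcal V\to\mathcal V_i$ is a (linear) projection, $Q_iv=v$ for $v\in\mathcal V_i$; $E_i:\mathcal V_i\to\mathbb R$ is Fréchet differentiable. Strong convexity of $E_i$: there is $\mu_i>0$ with $\langle E_i'(w)-E_i'(v),w-v\rangle\ge\mu_i\|w-v\|_{\mathcal V}^2$ for all $v,w\in\mathcal V_i$. Put $\chi=\frac{2L^2}{\mu\min_i\mu_i^2}(E(u_0)-E(u))$, $\mathcal B^+=\{v\in\mathcal V:\operatorname{dist}(v,\mathcal B)\le\sqrt\chi\}$, $\mathcal B_i=Q_i\mathcal B^+$. Lipschitz derivative of $E_i$: there is $L_i>0$ with $\|E_i'(w)-E_i'(v)\|_{\mathcal V_i'}\le L_i\|w-v\|_{\mathcal V}$ for all $w,v\in\mathcal B_i$ (dual norm over $\mathcal V_i$ with the norm $\|\cdot\|_{\mathcal V}$). FASD algorithm, $u^{k+1}={\rm FASD}(u^k)$: set $v_0=u^k$. For $i=1,\dots,N$: let $\xi_i=Q_iv_{i-1}$, $\tau_i=E_i'(\xi_i)-R_iE'(v_{i-1})\in\mathcal V_i'$; find $\eta_i\in\mathcal V_i$ with $\langle E_i'(\eta_i),w\rangle=\langle\tau_i,w\rangle$ for all $w\in\mathcal V_i$;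 set $s_i=\eta_i-\xi_i$, $\alpha_i^*=\operatorname{argmin}_{\alpha\in\mathbb R}E(v_{i-1}+\alpha s_i)$, $\varepsilon_i=\alpha_i^*s_i$ (with $\varepsilon_i=0$ if $s_i=0$), $v_i=v_{i-1}+\varepsilon_i$. Finally $u^{k+1}=v_N$. *)

theory Defs
  imports "HOL-Analysis.Analysis"
begin

text \<open>
  The Hilbert space is a type of class \<open>{real_inner, complete_space}\<close>, its dual is the type
  \<open>'v \<Rightarrow>\<^sub>L real\<close> with the operator norm. The subspaces are \<open>V 1, \<dots>, V N\<close>.

  A functional on a subspace \<open>S\<close> is represented by a functional on the whole space of which only the
  values on \<open>S\<close> are ever used; every bounded functional on \<open>S\<close> has such an extension. The restriction
  operator from the dual of the whole space to the dual of \<open>S\<close> is therefore invisible. A function on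
  \<open>S\<close> is likewise represented by a function on the whole space.
\<close>

definition dual_norm_on :: "'v::real_inner set \<Rightarrow> ('v \<Rightarrow>\<^sub>L real) \<Rightarrow> real"
  where \<comment> \<open>\<open>v = 0\<close> contributes \<open>0 / 0 = 0\<close>, so that the supremum is also meaningful for \<open>S = {0}\<close>\<close>
  "dual_norm_on S f = (SUP v\<in>S. blinfun_apply f v / norm v)"

definition frechet_deriv_on ::
    "'v::real_inner set \<Rightarrow> ('v \<Rightarrow> real) \<Rightarrow> ('v \<Rightarrow> 'v \<Rightarrow>\<^sub>L real) \<Rightarrow> bool"
  where
  "frechet_deriv_on S F F' \<longleftrightarrow>
     (\<forall>v\<in>S. (F has_derivative blinfun_apply (F' v)) (at v within S))"

definition strongly_convex_deriv_on ::
    "'v::real_inner set \<Rightarrow> ('v \<Rightarrow> 'v \<Rightarrow>\<^sub>L real) \<Rightarrow> real \<Rightarrow> bool"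
  where
  "strongly_convex_deriv_on S F' m \<longleftrightarrow>
     m > 0 \<and> (\<forall>v\<in>S. \<forall>w\<in>S. blinfun_apply (F' w - F' v) (w - v) \<ge> m * (norm (w - v))\<^sup>2)"

definition energy_sublevel :: "('v \<Rightarrow> real) \<Rightarrow> 'v \<Rightarrow> 'v set"
  where
  "energy_sublevel E u0 = {v. E v \<le> E u0}"

definition space_decomposition :: "nat \<Rightarrow> (nat \<Rightarrow> 'v::real_inner set) \<Rightarrow> bool"
  where
  "space_decomposition N V \<longleftrightarrow>
     (\<forall>i\<in>{1..N}. subspace (V i) \<and> closed (V i)) \<and>
     (\<forall>v. \<exists>d. (\<forall>i\<in>{1..N}. d i \<in> V i) \<and> v = (\<Sum>i=1..N. d i))"

definition stable_decomposition :: "nat \<Rightarrow> (nat \<Rightarrow> 'v::real_inner set) \<Rightarrow> real \<Rightarrow> bool"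
  where
  "stable_decomposition N V CA \<longleftrightarrow>
     CA > 0 \<and>
     (\<forall>v. \<exists>d. (\<forall>i\<in>{1..N}. d i \<in> V i) \<and> v = (\<Sum>i=1..N. d i) \<and>
              (\<Sum>i=1..N. (norm (d i))\<^sup>2) \<le> CA\<^sup>2 * (norm v)\<^sup>2)"

definition strengthened_cauchy_schwarz ::
    "nat \<Rightarrow> (nat \<Rightarrow> 'v::real_inner set) \<Rightarrow> ('v \<Rightarrow> 'v \<Rightarrow>\<^sub>L real) \<Rightarrow> 'v set \<Rightarrow> real \<Rightarrow> bool"
  where \<comment> \<open>only the \<open>w i j\<close> with \<open>i < j\<close> enter the sum\<close>
  "strengthened_cauchy_schwarz N V E' B CS \<longleftrightarrow>
     CS > 0 \<and>
     (\<forall>w u v.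
        (\<forall>i\<in>{1..N}. \<forall>j\<in>{1..N}. w i j \<in> B \<and> w i j + u j \<in> B) \<longrightarrow>
        (\<forall>j\<in>{1..N}. u j \<in> V j) \<longrightarrow>
        (\<forall>i\<in>{1..N}. v i \<in> V i) \<longrightarrow>
        (\<Sum>i=1..N. \<Sum>j=i+1..N. blinfun_apply (E' (w i j + u j) - E' (w i j)) (v i))
          \<le> CS * sqrt (\<Sum>i=1..N. (norm (u i))\<^sup>2) * sqrt (\<Sum>i=1..N. (norm (v i))\<^sup>2))"

definition subspace_projection :: "'v::real_inner set \<Rightarrow> ('v \<Rightarrow> 'v) \<Rightarrow> bool"
  where
  "subspace_projection S P \<longleftrightarrow> linear P \<and> (\<forall>v. P v \<in> S) \<and> (\<forall>v\<in>S. P v = v)"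

definition enlargement_radius_sq ::
    "nat \<Rightarrow> real \<Rightarrow> real \<Rightarrow> (nat \<Rightarrow> real) \<Rightarrow> ('v \<Rightarrow> real) \<Rightarrow> 'v \<Rightarrow> 'v \<Rightarrow> real"
  where \<comment> \<open>a bound on the squared norm of every search direction computed at a point with energy at most
    \<open>E u0\<close>, so that such a point plus its search direction lies in the enlarged set below\<close>
  "enlargement_radius_sq N L \<mu> \<mu>loc E u0 umin =
     2 * L\<^sup>2 / (\<mu> * Min ((\<lambda>i. (\<mu>loc i)\<^sup>2) ` {1..N})) * (E u0 - E umin)"

definition enlarged_set :: "'v::real_inner set \<Rightarrow> real \<Rightarrow> 'v set"
  where
  "enlarged_set B r2 = {v. infdist v B \<le> sqrt r2}"

text \<open>
  One subspace correction \<open>x \<mapsto> y\<close> on \<open>S\<close> with projection \<open>P\<close> and local energy derivative \<open>G'\<close>.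
  If \<open>s = 0\<close>, every \<open>\<alpha>\<close> minimizes along the line and the correction \<open>\<alpha> *\<^sub>R s\<close> vanishes.
\<close>

definition fasd_correction ::
    "('v::real_inner \<Rightarrow> real) \<Rightarrow> ('v \<Rightarrow> 'v \<Rightarrow>\<^sub>L real) \<Rightarrow> 'v set \<Rightarrow> ('v \<Rightarrow> 'v) \<Rightarrow>
     ('v \<Rightarrow> 'v \<Rightarrow>\<^sub>L real) \<Rightarrow> 'v \<Rightarrow> 'v \<Rightarrow> bool"
  where
  "fasd_correction E E' S P G' x y \<longleftrightarrow>
     (\<exists>\<xi> \<tau> \<eta> s \<alpha>.
        \<xi> = P x \<and>
        \<tau> = G' \<xi> - E' x \<and>
        \<eta> \<in> S \<and> (\<forall>w\<in>S. blinfun_apply (G' \<eta>) w = blinfun_apply \<tau> w) \<and>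
        s = \<eta> - \<xi> \<and>
        is_arg_min (\<lambda>a. E (x + a *\<^sub>R s)) (\<lambda>_. True) \<alpha> \<and>
        y = x + \<alpha> *\<^sub>R s)"

text \<open>
  One sweep \<open>x \<mapsto> y\<close> over all subspaces. The local energy of the \<open>i\<close>-th step may depend on the
  current point \<open>v (i - 1)\<close>, which is passed as the second argument of \<open>G'\<close>.
\<close>

definition fasd ::
    "nat \<Rightarrow> (nat \<Rightarrow> 'v::real_inner set) \<Rightarrow> (nat \<Rightarrow> 'v \<Rightarrow> 'v) \<Rightarrow> ('v \<Rightarrow> real) \<Rightarrow> ('v \<Rightarrow> 'v \<Rightarrow>\<^sub>L real) \<Rightarrow>
     (nat \<Rightarrow> 'v \<Rightarrow> 'v \<Rightarrow> 'v \<Rightarrow>\<^sub>L real) \<Rightarrow> 'v \<Rightarrow> 'v \<Rightarrow> bool"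
  where
  "fasd N V Q E E' G' x y \<longleftrightarrow>
     (\<exists>v. v 0 = x \<and>
          (\<forall>i\<in>{1..N}. fasd_correction E E' (V i) (Q i) (G' i (v (i - 1))) (v (i - 1)) (v i)) \<and>
          y = v N)"

definition fasd_iterates ::
    "nat \<Rightarrow> (nat \<Rightarrow> 'v::real_inner set) \<Rightarrow> (nat \<Rightarrow> 'v \<Rightarrow> 'v) \<Rightarrow> ('v \<Rightarrow> real) \<Rightarrow> ('v \<Rightarrow> 'v \<Rightarrow>\<^sub>L real) \<Rightarrow>
     (nat \<Rightarrow> 'v \<Rightarrow> 'v \<Rightarrow> 'v \<Rightarrow>\<^sub>L real) \<Rightarrow> 'v \<Rightarrow> (nat \<Rightarrow> 'v) \<Rightarrow> bool"
  where
  "fasd_iterates N V Q E E' G' u0 u \<longleftrightarrow>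
     u 0 = u0 \<and> (\<forall>k. fasd N V Q E E' G' (u k) (u (Suc k)))"

definition quadratic_local_energy ::
    "(nat \<Rightarrow> 'v \<Rightarrow> 'v) \<Rightarrow> nat \<Rightarrow> 'v \<Rightarrow> 'v::real_inner \<Rightarrow> real"
  where
  "quadratic_local_energy Q i x w = 1 / 2 * (norm (w - Q i x))\<^sup>2"

end

theory Submission
  imports Defs
begin

text \<open>
  Exact line search makes \<open>E' (v i)\<close> vanish on the search direction \<open>s i\<close>, so the \<open>i\<close>-th correction
  \<open>\<epsilon> i\<close> lowers \<open>E\<close> by at least \<open>\<mu> / 2 * (norm (\<epsilon> i))\<^sup>2\<close>, while strong convexity of the local energy
  gives \<open>\<mu>loc i * norm (s i) \<le> L * norm (\<epsilon> i)\<close>. After a sweep, \<open>E (v N) - E umin\<close> is controlled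
  by \<open>E' (v N) (v N - umin)\<close>. Split \<open>v N - umin\<close> into a stable sum of \<open>d i\<close>; telescope
  \<open>E' (v N) - E' (v i)\<close> for the strengthened Cauchy--Schwarz inequality, and bound
  \<open>E' (v (i - 1)) (d i)\<close>, a difference of local derivatives, by \<open>Lloc i * norm (s i) * norm (d i)\<close>.
  Hence the remaining error is at most a constant times the energy decrease of the sweep.
\<close>

section \<open>Strong convexity and exact line search\<close>

text \<open>The line stays in \<open>S\<close>, so differentiability within \<open>S\<close>
  suffices. This serves both \<open>E\<close> on the whole space and local energies on a
  subspace.\<close>

lemma frechet_deriv_on_line:
  assumes "frechet_deriv_on S F F'" "subspace S" "x \<in> S" "s \<in> S"
  shows "((\<lambda>a. F (x + a *\<^sub>R s)) has_real_derivative blinfun_apply (F' (x + t *\<^sub>R s)) s) (at t)"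
proof -
  have *: "x + a *\<^sub>R s \<in> S" for a
    using assms by (simp add: subspace_add subspace_scale)
  have "((\<lambda>a. x + a *\<^sub>R s) has_derivative (\<lambda>h. h *\<^sub>R s)) (at t)"
    by (auto intro!: derivative_eq_intros)
  moreover have "(F has_derivative blinfun_apply (F' (x + t *\<^sub>R s)))
      (at (x + t *\<^sub>R s) within range (\<lambda>a. x + a *\<^sub>R s))"
    using assms(1) * unfolding frechet_deriv_on_def
    by (meson has_derivative_subset image_subsetI)
  ultimately have "((\<lambda>a. F (x + a *\<^sub>R s)) has_derivative
      (\<lambda>h. blinfun_apply (F' (x + t *\<^sub>R s)) (h *\<^sub>R s))) (at t)"
    by (rule has_derivative_in_compose)
  then show ?thesis
    by (simp add: has_field_derivative_def blinfun.scaleR_right mult.commute[of _ "blinfun_apply _ _"])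
qed

text \<open>Along the segment from \<open>v\<close> to \<open>w\<close>, \<open>E\<close> minus its
  linearization and the quadratic term has nonnegative derivative.\<close>

lemma strongly_convex_lower_bound:
  assumes E: "frechet_deriv_on UNIV E E'" and sc: "strongly_convex_deriv_on UNIV E' \<mu>"
  shows "E v + blinfun_apply (E' v) (w - v) + \<mu> / 2 * (norm (w - v))\<^sup>2 \<le> E w"
proof -
  define d where "d = w - v"
  define g where "g t = E (v + t *\<^sub>R d) - t * blinfun_apply (E' v) d - \<mu> / 2 * t\<^sup>2 * (norm d)\<^sup>2" for t
  have deriv: "(g has_real_derivative
      (blinfun_apply (E' (v + t *\<^sub>R d)) d - blinfun_apply (E' v) d - \<mu> * t * (norm d)\<^sup>2)) (at t)" for t
    unfolding g_def
    by (rule derivative_eq_intros frechet_deriv_on_line[OF E] refl | simp)+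
  have nonneg: "0 \<le> blinfun_apply (E' (v + t *\<^sub>R d)) d - blinfun_apply (E' v) d - \<mu> * t * (norm d)\<^sup>2"
    if "0 \<le> t" for t
  \<comment> \<open>Strong convexity between \<open>v\<close> and \<open>v + t *\<^sub>R d\<close>
    gives the claim multiplied by \<open>t\<close>; at \<open>t = 0\<close> all terms
    cancel.\<close>
  proof (cases "t = 0")
    case False
    have "\<mu> * (norm (v + t *\<^sub>R d - v))\<^sup>2
        \<le> blinfun_apply (E' (v + t *\<^sub>R d) - E' v) (v + t *\<^sub>R d - v)"
      using sc unfolding strongly_convex_deriv_on_def by blast
    then have "t * (\<mu> * t * (norm d)\<^sup>2) \<le> t * (blinfun_apply (E' (v + t *\<^sub>R d)) d - blinfun_apply (E' v) d)"
      by (simp add: blinfun.scaleR_right blinfun.diff_left power_mult_distrib power2_eq_square mult_ac)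
    then show ?thesis
      using False that by (simp add: mult_le_cancel_left)
  qed simp
  have "g 0 \<le> g 1"
    by (rule DERIV_nonneg_imp_nondecreasing[of 0 1 g]) (use deriv nonneg in fastforce)+
  then show ?thesis
    by (simp add: g_def d_def)
qed

lemma exact_line_search_orthogonal:
  assumes "frechet_deriv_on UNIV E E'" "is_arg_min (\<lambda>a. E (x + a *\<^sub>R s)) (\<lambda>_. True) \<alpha>"
  shows "blinfun_apply (E' (x + \<alpha> *\<^sub>R s)) s = 0"
proof -
  have "((\<lambda>a. E (x + a *\<^sub>R s)) has_real_derivative blinfun_apply (E' (x + \<alpha> *\<^sub>R s)) s) (at \<alpha>)"
    using assms(1) by (rule frechet_deriv_on_line) auto
  then show ?thesis
    by (rule DERIV_local_min[of _ _ _ 1]) (use assms(2) in \<open>auto simp: is_arg_min_def not_less\<close>)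
qed

section \<open>Dual norms on a subspace\<close>

lemma dual_norm_on_bound:
  assumes "v \<in> S"
  shows "blinfun_apply f v \<le> dual_norm_on S f * norm v"
proof (cases "v = 0")
  case False
  \<comment> \<open>A real supremum dominates its members only if the family is bounded above; the
    operator norm on the whole space provides a bound.\<close>
  have "blinfun_apply f w / norm w \<le> norm f" for w
    using norm_blinfun[of f w] by (cases "w = 0") (auto simp: divide_simps)
  then have "bdd_above ((\<lambda>w. blinfun_apply f w / norm w) ` S)"
    by (auto intro!: bdd_aboveI[of _ "norm f"])
  then have "blinfun_apply f v / norm v \<le> dual_norm_on S f"
    unfolding dual_norm_on_def by (rule cSUP_upper[OF assms])
  then show ?thesis
    using False by (simp add: divide_simps)
qed (simp add: blinfun.zero_right)

lemma dual_norm_on_le: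
  assumes "S \<noteq> {}" "0 \<le> C" "\<And>v. v \<in> S \<Longrightarrow> blinfun_apply f v \<le> C * norm v"
  shows "dual_norm_on S f \<le> C"
  unfolding dual_norm_on_def
proof (rule cSUP_least)
  show "blinfun_apply f v / norm v \<le> C" if "v \<in> S" for v
    using assms(3)[OF that] assms(2) by (cases "v = 0") (auto simp: divide_simps)
qed (rule assms(1))

section \<open>Search direction and energy decrease of one correction\<close>

text \<open>Here \<open>s\<close> is the search direction. The last conclusion expresses the
  residual at \<open>x\<close> as a difference of local derivatives, the form to which Lipschitz
  continuity of \<open>G'\<close> applies.\<close>

lemma fasd_correction_estimates:
  assumes E: "frechet_deriv_on UNIV E E'" and sc: "strongly_convex_deriv_on UNIV E' \<mu>"
    and S: "subspace S" and P: "subspace_projection S P"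
    and scl: "strongly_convex_deriv_on S G' m"
    and step: "fasd_correction E E' S P G' x y"
  obtains s where "s \<in> S" "y - x \<in> S"
    and "m * norm s \<le> norm (E' y - E' x)"
    and "\<mu> / 2 * (norm (y - x))\<^sup>2 \<le> E x - E y"
    and "\<And>w. w \<in> S \<Longrightarrow> blinfun_apply (E' x) w = blinfun_apply (G' (P x) - G' (P (x + s))) w"
proof -
  from step obtain \<eta> \<alpha> where \<eta>: "\<eta> \<in> S"
    and eq: "\<And>w. w \<in> S \<Longrightarrow> blinfun_apply (G' \<eta>) w = blinfun_apply (G' (P x) - E' x) w"
    and min: "is_arg_min (\<lambda>a. E (x + a *\<^sub>R (\<eta> - P x))) (\<lambda>_. True) \<alpha>"
    and y: "y = x + \<alpha> *\<^sub>R (\<eta> - P x)"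
    unfolding fasd_correction_def by blast
  define s where "s = \<eta> - P x"
  have Px: "P x \<in> S" and lin: "linear P" and idem: "\<And>v. v \<in> S \<Longrightarrow> P v = v"
    using P by (auto simp: subspace_projection_def)
  have s: "s \<in> S"
    using \<eta> Px S by (simp add: s_def subspace_diff)
  \<comment> \<open>This makes \<eta> the projection of the ambient point \<open>x + s\<close>, as
    required for a Lipschitz condition stated on projected sets.\<close>
  have P_s: "P (x + s) = \<eta>"
    using idem[OF s] by (simp add: linear_add[OF lin]) (simp add: s_def)
  have orth: "blinfun_apply (E' y) s = 0"
    using exact_line_search_orthogonal[OF E min] by (simp add: y s_def)
  have "m * (norm s)\<^sup>2 \<le> blinfun_apply (G' \<eta> - G' (P x)) s"
    using scl \<eta> Px unfolding strongly_convex_deriv_on_def s_def by blast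
  \<comment> \<open>The local equation gives \<open>- E' x\<close> on \<open>s\<close>;
    \<open>E' y\<close> is inserted at no cost because it vanishes there.\<close>
  also have "\<dots> = blinfun_apply (E' y - E' x) s"
    using eq[OF s] orth by (simp add: blinfun.diff_left)
  also have "\<dots> \<le> norm (E' y - E' x) * norm s"
    using norm_blinfun[of "E' y - E' x" s] by simp
  finally have *: "m * norm s \<le> norm (E' y - E' x)"
    by (cases "s = 0") (auto simp: power2_eq_square)
  have "x - y = - \<alpha> *\<^sub>R s"
    by (simp add: y s_def)
  \<comment> \<open>Hence the lower bound for \<open>E\<close> expanded at \<open>y\<close> loses
    its linear term.\<close>
  then have "blinfun_apply (E' y) (x - y) = 0"
    using orth by (simp add: blinfun.scaleR_right blinfun.minus_right)
  then have "\<mu> / 2 * (norm (y - x))\<^sup>2 \<le> E x - E y"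
    using strongly_convex_lower_bound[OF E sc, of y x] by (simp add: norm_minus_commute)
  moreover have "y - x \<in> S"
    using s S by (simp add: y s_def[symmetric] subspace_scale)
  ultimately show thesis
    using that[OF s] * eq P_s by (simp add: blinfun.diff_left)
qed

section \<open>From energy decrease to a contraction factor\<close>

text \<open>Young's inequality absorbs the factor \<open>b = norm (y - umin)\<close> into the quadratic term of strong
  convexity.\<close>

lemma contraction_from_decrease:
  fixes a b c p q \<mu> S :: real
  assumes \<mu>: "0 < \<mu>" and S: "0 \<le> S"
    and dec: "\<mu> / 2 * S \<le> p - q"
    and err: "q \<le> c * sqrt S * b - \<mu> / 2 * b\<^sup>2"
  shows "q \<le> c\<^sup>2 / (c\<^sup>2 + \<mu>\<^sup>2) * p"
proof -
  have "0 \<le> (c * sqrt S - \<mu> * b)\<^sup>2"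
    by simp
  also have "\<dots> = c\<^sup>2 * S - 2 * \<mu> * (c * sqrt S * b - \<mu> / 2 * b\<^sup>2)"
    using S by (simp add: power2_diff power_mult_distrib) (simp add: algebra_simps power2_eq_square)
  finally have "2 * \<mu> * (c * sqrt S * b - \<mu> / 2 * b\<^sup>2) \<le> c\<^sup>2 * S"
    by simp
  moreover have "2 * \<mu> * q \<le> 2 * \<mu> * (c * sqrt S * b - \<mu> / 2 * b\<^sup>2)"
    using err \<mu> by (intro mult_left_mono) simp_all
  ultimately have "2 * \<mu> * q \<le> c\<^sup>2 * S"
    by (rule order_trans[rotated])
  \<comment> \<open>So far \<open>q\<close> is at most a multiple of \<open>S\<close>. Now
    \<open>dec\<close> replaces \<open>S\<close> by a multiple of \<open>p - q\<close>, and
    collecting \<open>q\<close> gives the factor.\<close>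
  then have "\<mu> * (2 * \<mu> * q) \<le> \<mu> * (c\<^sup>2 * S)"
    using \<mu> by (intro mult_left_mono) auto
  moreover have "2 * c\<^sup>2 * (\<mu> / 2 * S) \<le> 2 * c\<^sup>2 * (p - q)"
    using dec by (intro mult_left_mono) auto
  ultimately have "q * (c\<^sup>2 + \<mu>\<^sup>2) \<le> c\<^sup>2 * p"
    by (simp add: algebra_simps power2_eq_square)
  moreover have "0 < c\<^sup>2 + \<mu>\<^sup>2"
    using \<mu> by (simp add: add_nonneg_pos)
  ultimately show ?thesis
    by (simp add: pos_le_divide_eq)
qed

section \<open>Residual after one correction\<close>

text \<open>The length of \<open>s\<close> is controlled by that of the correction, hence by the
  energy drop, which is at most \<open>E u0 - E umin\<close>. The minimum over the local constants
  makes the radius common to all subspaces.\<close>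

lemma search_direction_in_enlarged_set:
  assumes "0 < \<mu>" "i \<in> {1..N}" "\<forall>i\<in>{1..N}. 0 < \<mu>loc i"
    and x: "E x \<le> E u0" and y: "E umin \<le> E y"
    and s: "\<mu>loc i * norm s \<le> L * norm (y - x)"
    and dec: "\<mu> / 2 * (norm (y - x))\<^sup>2 \<le> E x - E y"
  shows "x + s \<in> enlarged_set (energy_sublevel E u0) (enlargement_radius_sq N L \<mu> \<mu>loc E u0 umin)"
proof -
  define m where "m = Min ((\<lambda>i. (\<mu>loc i)\<^sup>2) ` {1..N})"
  have m_le: "m \<le> (\<mu>loc i)\<^sup>2"
    unfolding m_def using assms(2) by (intro Min_le) auto
  have m_pos: "0 < m"
    unfolding m_def using assms(2,3) by (subst Min_gr_iff) (auto intro!: zero_less_power)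
  have "m * (norm s)\<^sup>2 \<le> (\<mu>loc i * norm s)\<^sup>2"
    using m_le by (simp add: power_mult_distrib mult_right_mono)
  also have "\<dots> \<le> (L * norm (y - x))\<^sup>2"
    using s assms(2,3) by (intro power_mono mult_nonneg_nonneg) (auto intro: less_imp_le)
  finally have "\<mu> * m * (norm s)\<^sup>2 \<le> \<mu> * (L * norm (y - x))\<^sup>2"
    using assms(1) by (simp add: mult_left_mono mult.assoc)
  also have "\<dots> = 2 * L\<^sup>2 * (\<mu> / 2 * (norm (y - x))\<^sup>2)"
    by (simp add: power_mult_distrib)
  also have "\<dots> \<le> 2 * L\<^sup>2 * (E u0 - E umin)"
    using dec x y by (intro mult_left_mono) auto
  finally have "(norm s)\<^sup>2 \<le> enlargement_radius_sq N L \<mu> \<mu>loc E u0 umin"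
    using assms(1) m_pos unfolding enlargement_radius_sq_def m_def[symmetric]
    by (simp add: field_simps)
  then have "norm s \<le> sqrt (enlargement_radius_sq N L \<mu> \<mu>loc E u0 umin)"
    by (rule real_le_rsqrt)
  moreover have "infdist (x + s) (energy_sublevel E u0) \<le> norm s"
    using infdist_le[of x "energy_sublevel E u0" "x + s"] x
    by (simp add: energy_sublevel_def dist_norm)
  ultimately show ?thesis
    by (simp add: enlarged_set_def)
qed

text \<open>Split \<open>E' y\<close> into \<open>E' x\<close> and \<open>E' y - E' x\<close>. The
  second part contributes the \<open>1\<close> in the factor, the local Lipschitz bound on the first
  contributes \<open>l / \<mu>loc i\<close>.\<close>

lemma fasd_correction_residual_bound:
  assumes E: "frechet_deriv_on UNIV E E'" and sc: "strongly_convex_deriv_on UNIV E' \<mu>"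
    and lip: "\<forall>v\<in>energy_sublevel E u0. \<forall>w\<in>energy_sublevel E u0. norm (E' w - E' v) \<le> L * norm (w - v)"
    and umin: "is_arg_min E (\<lambda>_. True) umin"
    and i: "i \<in> {1..N}" and S: "subspace S" and P: "subspace_projection S P"
    and m: "\<forall>i\<in>{1..N}. 0 < \<mu>loc i"
    and scl: "strongly_convex_deriv_on S G' (\<mu>loc i)"
    and l: "0 < l"
    and lipl: "\<forall>v\<in>P ` enlarged_set (energy_sublevel E u0) (enlargement_radius_sq N L \<mu> \<mu>loc E u0 umin).
      \<forall>w\<in>P ` enlarged_set (energy_sublevel E u0) (enlargement_radius_sq N L \<mu> \<mu>loc E u0 umin).
        dual_norm_on S (G' w - G' v) \<le> l * norm (w - v)"
    and x: "E x \<le> E u0"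
    and step: "fasd_correction E E' S P G' x y"
  shows "E y \<le> E x" "y - x \<in> S" "\<mu> / 2 * (norm (y - x))\<^sup>2 \<le> E x - E y"
    and "\<And>w. w \<in> S \<Longrightarrow> blinfun_apply (E' y) w \<le> L * (1 + l / \<mu>loc i) * norm (y - x) * norm w"
proof -
  obtain s where s: "s \<in> S" and yx: "y - x \<in> S"
    and ms: "\<mu>loc i * norm s \<le> norm (E' y - E' x)"
    and dec: "\<mu> / 2 * (norm (y - x))\<^sup>2 \<le> E x - E y"
    and res: "\<And>w. w \<in> S \<Longrightarrow> blinfun_apply (E' x) w = blinfun_apply (G' (P x) - G' (P (x + s))) w"
    by (rule fasd_correction_estimates[OF E sc S P scl step]) blast
  have \<mu>: "0 < \<mu>" and mi: "0 < \<mu>loc i"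
    using sc m i by (auto simp: strongly_convex_deriv_on_def)
  have "0 \<le> \<mu> / 2 * (norm (y - x))\<^sup>2"
    using \<mu> by simp
  with dec show le: "E y \<le> E x"
    by linarith
  show "y - x \<in> S" "\<mu> / 2 * (norm (y - x))\<^sup>2 \<le> E x - E y"
    by fact+
  have min: "E umin \<le> E v" for v
    using umin by (auto simp: is_arg_min_def not_less)
  have L_yx: "norm (E' y - E' x) \<le> L * norm (y - x)"
    using lip x le by (simp add: energy_sublevel_def)
  then have ms': "\<mu>loc i * norm s \<le> L * norm (y - x)"
    using ms by linarith
  let ?B = "enlarged_set (energy_sublevel E u0) (enlargement_radius_sq N L \<mu> \<mu>loc E u0 umin)"
  have "x + s \<in> ?B"
    by (rule search_direction_in_enlarged_set[where E = E, OF \<mu> i m x min ms' dec])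
  \<comment> \<open>The trivial step \<open>y = x\<close>, \<open>s = 0\<close>; it covers in
    particular the sign of the radius.\<close>
  moreover have "x \<in> ?B"
    using search_direction_in_enlarged_set[where E = E and y = x and s = 0, OF \<mu> i m x min] by simp
  ultimately have "dual_norm_on S (G' (P x) - G' (P (x + s))) \<le> l * norm (P x - P (x + s))"
    using lipl by blast
  \<comment> \<open>\<open>P\<close> is linear and fixes \<open>s\<close>, so the norm of
    \<open>P\<close> does not enter.\<close>
  also have "P x - P (x + s) = - s"
    using P s by (simp add: subspace_projection_def linear_add)
  finally have dn: "dual_norm_on S (G' (P x) - G' (P (x + s))) \<le> l * norm s"
    by simp
  fix w assume w: "w \<in> S"
  have "blinfun_apply (E' x) w \<le> l * norm s * norm w"
    using res[OF w] dual_norm_on_bound[OF w, of "G' (P x) - G' (P (x + s))"] mult_right_mono[OF dn norm_ge_zero[of w]]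
    by linarith
  also have "\<dots> \<le> l * (L * norm (y - x) / \<mu>loc i) * norm w"
    using ms' mi l by (intro mult_right_mono mult_left_mono) (auto simp: field_simps)
  finally have 1: "blinfun_apply (E' x) w \<le> l * (L * norm (y - x) / \<mu>loc i) * norm w" .
  have "blinfun_apply (E' y - E' x) w \<le> norm (E' y - E' x) * norm w"
    using norm_blinfun[of "E' y - E' x" w] by simp
  also have "\<dots> \<le> L * norm (y - x) * norm w"
    using L_yx by (rule mult_right_mono) simp
  finally show "blinfun_apply (E' y) w \<le> L * (1 + l / \<mu>loc i) * norm (y - x) * norm w"
    using 1 by (simp add: blinfun.diff_left algebra_simps)
qed

section \<open>Contraction of a sweep and of the iteration\<close>

text \<open>The point argument of \<open>G'\<close> admits both fixed local energies and quadratics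
  recentred at every step.\<close>

lemma fasd_sweep_contraction:
  assumes N: "N \<ge> 1"
    and E: "frechet_deriv_on UNIV E E'" and sc: "strongly_convex_deriv_on UNIV E' \<mu>"
    and lip: "\<forall>v\<in>energy_sublevel E u0. \<forall>w\<in>energy_sublevel E u0. norm (E' w - E' v) \<le> L * norm (w - v)"
    and umin: "is_arg_min E (\<lambda>_. True) umin"
    and V: "space_decomposition N V"
    and stab: "stable_decomposition N V CA"
    and scs: "strengthened_cauchy_schwarz N V E' (energy_sublevel E u0) CS"
    and Q: "\<forall>i\<in>{1..N}. subspace_projection (V i) (Q i)"
    and scl: "\<forall>i\<in>{1..N}. \<forall>x. strongly_convex_deriv_on (V i) (G' i x) (\<mu>loc i)"
    and l: "\<forall>i\<in>{1..N}. 0 < Lloc i"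
    and lipl: "\<forall>i\<in>{1..N}. \<forall>x.
      \<forall>v\<in>Q i ` enlarged_set (energy_sublevel E u0) (enlargement_radius_sq N L \<mu> \<mu>loc E u0 umin).
      \<forall>w\<in>Q i ` enlarged_set (energy_sublevel E u0) (enlargement_radius_sq N L \<mu> \<mu>loc E u0 umin).
        dual_norm_on (V i) (G' i x w - G' i x v) \<le> Lloc i * norm (w - v)"
    and x: "E x \<le> E u0"
    and sweep: "fasd N V Q E E' G' x y"
    and K: "K = CS + L * (1 + Max ((\<lambda>i. Lloc i / \<mu>loc i) ` {1..N}))"
  shows "E y \<le> E x" "E y - E umin \<le> CA\<^sup>2 * K\<^sup>2 / (CA\<^sup>2 * K\<^sup>2 + \<mu>\<^sup>2) * (E x - E umin)"
proof -
  obtain v where v0: "v 0 = x" and vN: "y = v N"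
    and step: "\<And>i. i \<in> {1..N} \<Longrightarrow> fasd_correction E E' (V i) (Q i) (G' i (v (i - 1))) (v (i - 1)) (v i)"
    using sweep unfolding fasd_def by blast
  have \<mu>: "0 < \<mu>" and m: "\<forall>i\<in>{1..N}. 0 < \<mu>loc i"
    using sc scl by (auto simp: strongly_convex_deriv_on_def)
  have min: "E umin \<le> E w" for w
    using umin by (auto simp: is_arg_min_def not_less)
  have sub: "\<And>i. i \<in> {1..N} \<Longrightarrow> subspace (V i)"
    using V by (simp add: space_decomposition_def)
  note res = fasd_correction_residual_bound[OF E sc lip umin _ sub _ m _ _ _ _ step]
  \<comment> \<open>Monotonicity comes first: it keeps all intermediate points in the sublevel set,
    where the hypotheses on \<open>E'\<close> hold.\<close>
  have v_le: "E (v i) \<le> E x" if "i \<le> N" for i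
    using that
  proof (induction i)
    case (Suc i)
    then have "i + 1 \<in> {1..N}" "E (v i) \<le> E u0"
      using x by auto
    then have "E (v (i + 1)) \<le> E (v i)"
      using res(1)[of "i + 1" "i + 1" "Lloc (i + 1)"] scl l lipl Q by simp
    then show ?case
      using Suc by simp
  qed (simp add: v0)
  then show le: "E y \<le> E x"
    by (simp add: vN)
  have v_le': "E (v (i - 1)) \<le> E u0" if "i \<in> {1..N}" for i
    using v_le[of "i - 1"] that x by force
  define e where "e i = v i - v (i - 1)" for i
  have e_in: "e i \<in> V i"
    and dec: "\<mu> / 2 * (norm (e i))\<^sup>2 \<le> E (v (i - 1)) - E (v i)"
    and resid: "\<And>w. w \<in> V i \<Longrightarrow>
      blinfun_apply (E' (v i)) w \<le> L * (1 + Lloc i / \<mu>loc i) * norm (e i) * norm w"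
    if "i \<in> {1..N}" for i
    using res(2-4)[of i i "Lloc i"] that scl l lipl Q v_le'[OF that] by (simp_all add: e_def)
  define S where "S = (\<Sum>i=1..N. (norm (e i))\<^sup>2)"
  have S: "0 \<le> S"
    by (simp add: S_def sum_nonneg)
  have "\<mu> / 2 * S \<le> (\<Sum>i=1..N. E (v (i - 1)) - E (v i))"
    unfolding S_def sum_distrib_left by (intro sum_mono dec)
  also have "\<dots> = - (\<Sum>i=Suc 0..N. E (v i) - E (v (i - 1)))"
    by (simp add: sum_negf[symmetric])
  also have "\<dots> = E x - E y"
    by (subst sum_telescope'') (auto simp: v0 vN)
  finally have decrease: "\<mu> / 2 * S \<le> (E x - E umin) - (E y - E umin)"
    by simp
  show "E y - E umin \<le> CA\<^sup>2 * K\<^sup>2 / (CA\<^sup>2 * K\<^sup>2 + \<mu>\<^sup>2) * (E x - E umin)"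
  \<comment> \<open>If \<open>u0\<close> is the minimizer, both energy errors are zero. Otherwise
    the sublevel set has two distinct points, which forces \<open>0 \<le> L\<close>.\<close>
  proof (cases "u0 = umin")
    case True
    then have "E x = E umin" "E y = E umin"
      using min[of x] min[of y] x le by simp_all
    then show ?thesis
      by simp
  next
    case False
    have "norm (E' u0 - E' umin) \<le> L * norm (u0 - umin)"
      using lip min[of u0] by (simp add: energy_sublevel_def)
    then have "0 \<le> L * norm (u0 - umin)"
      using norm_ge_zero order_trans by blast
    then have L: "0 \<le> L"
      using False by (simp add: zero_le_mult_iff)
    define M where "M = Max ((\<lambda>i. Lloc i / \<mu>loc i) ` {1..N})"
    have K': "K = CS + L * (1 + M)"
      by (simp only: K M_def)
    have M: "Lloc i / \<mu>loc i \<le> M" if "i \<in> {1..N}" for i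
      unfolding M_def using that by (intro Max_ge) auto
    have "0 \<le> Lloc 1 / \<mu>loc 1"
      using l m N by (auto intro!: divide_nonneg_pos intro: less_imp_le)
    then have M0: "0 \<le> M"
      using M[of 1] N by simp
    have CA: "0 < CA" and CS: "0 < CS"
      using stab scs by (auto simp: stable_decomposition_def strengthened_cauchy_schwarz_def)
    obtain d where d: "\<And>i. i \<in> {1..N} \<Longrightarrow> d i \<in> V i" and d_sum: "y - umin = (\<Sum>i=1..N. d i)"
      and d_norm: "(\<Sum>i=1..N. (norm (d i))\<^sup>2) \<le> CA\<^sup>2 * (norm (y - umin))\<^sup>2"
      using stab unfolding stable_decomposition_def by blast
    define D where "D = sqrt (\<Sum>i=1..N. (norm (d i))\<^sup>2)"
    have D: "D \<le> CA * norm (y - umin)"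
      using real_sqrt_le_mono[OF d_norm] CA by (simp add: D_def real_sqrt_mult)
    \<comment> \<open>The strengthened Cauchy--Schwarz inequality is used with
      \<open>w i j = v (j - 1)\<close>, independent of \<open>i\<close>, and
      \<open>u j = e j\<close>, so that \<open>w i j + u j = v j\<close>.\<close>
    have "v (j - 1) \<in> energy_sublevel E u0 \<and> v (j - 1) + e j \<in> energy_sublevel E u0"
      if "j \<in> {1..N}" for j
      using v_le'[OF that] v_le[of j] that x by (simp add: e_def energy_sublevel_def)
    then have "(\<Sum>i=1..N. \<Sum>j=i+1..N. blinfun_apply (E' (v (j - 1) + e j) - E' (v (j - 1))) (d i))
        \<le> CS * sqrt S * D"
      unfolding S_def D_def
      using scs[unfolded strengthened_cauchy_schwarz_def, THEN conjunct2, THEN spec, THEN spec,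
          THEN spec, of "\<lambda>i j. v (j - 1)" e d] e_in d
      by blast
    \<comment> \<open>Each inner sum telescopes. As it starts at \<open>i + 1\<close>, it leaves
      \<open>E' (v i)\<close>, the residual just after the \<open>i\<close>-th correction, which
      \<open>resid\<close> bounds.\<close>
    also have "(\<Sum>i=1..N. \<Sum>j=i+1..N. blinfun_apply (E' (v (j - 1) + e j) - E' (v (j - 1))) (d i))
        = (\<Sum>i=1..N. blinfun_apply (E' y) (d i) - blinfun_apply (E' (v i)) (d i))"
    proof (rule sum.cong[OF refl])
      fix i assume "i \<in> {1..N}"
      then show "(\<Sum>j=i+1..N. blinfun_apply (E' (v (j - 1) + e j) - E' (v (j - 1))) (d i))
          = blinfun_apply (E' y) (d i) - blinfun_apply (E' (v i)) (d i)"
        using sum_telescope''[of i N "\<lambda>j. blinfun_apply (E' (v j)) (d i)"]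
        by (simp add: e_def vN blinfun.diff_left)
    qed
    finally have 1: "(\<Sum>i=1..N. blinfun_apply (E' y) (d i)) - (\<Sum>i=1..N. blinfun_apply (E' (v i)) (d i))
        \<le> CS * sqrt S * D"
      by (simp add: sum_subtractf)
    have "(\<Sum>i=1..N. blinfun_apply (E' (v i)) (d i))
        \<le> (\<Sum>i=1..N. L * (1 + M) * (norm (e i) * norm (d i)))"
    proof (rule sum_mono)
      fix i assume i: "i \<in> {1..N}"
      have "blinfun_apply (E' (v i)) (d i) \<le> L * (1 + Lloc i / \<mu>loc i) * norm (e i) * norm (d i)"
        using resid[OF i d[OF i]] .
      also have "\<dots> \<le> L * (1 + M) * norm (e i) * norm (d i)"
        using M[OF i] L by (intro mult_right_mono mult_left_mono add_left_mono) auto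
      finally show "blinfun_apply (E' (v i)) (d i) \<le> L * (1 + M) * (norm (e i) * norm (d i))"
        by (simp add: mult.assoc)
    qed
    also have "\<dots> = L * (1 + M) * (\<Sum>i=1..N. norm (e i) * norm (d i))"
      by (simp add: sum_distrib_left)
    also have "\<dots> \<le> L * (1 + M) * (sqrt S * D)"
      using L2_set_mult_ineq[of "\<lambda>i. norm (e i)" "\<lambda>i. norm (d i)" "{1..N}"] L M0
      by (intro mult_left_mono) (auto simp: L2_set_def S_def D_def)
    finally have "(\<Sum>i=1..N. blinfun_apply (E' y) (d i)) \<le> K * sqrt S * D"
      using 1 by (simp add: K' algebra_simps)
    also have "\<dots> \<le> K * sqrt S * (CA * norm (y - umin))"
      using D S CS L M0 by (intro mult_left_mono) (auto simp: K')
    finally have "blinfun_apply (E' y) (y - umin) \<le> (CA * K) * sqrt S * norm (y - umin)"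
      by (simp add: d_sum blinfun.sum_right mult_ac)
    moreover have "E y - E umin
        \<le> blinfun_apply (E' y) (y - umin) - \<mu> / 2 * (norm (y - umin))\<^sup>2"
      using strongly_convex_lower_bound[OF E sc, of y umin]
      by (simp add: norm_minus_commute blinfun.diff_right)
    ultimately have "E y - E umin
        \<le> (CA * K) * sqrt S * norm (y - umin) - \<mu> / 2 * (norm (y - umin))\<^sup>2"
      by linarith
    \<comment> \<open>Here \<open>c = CA * K\<close>, and \<open>p\<close>, \<open>q\<close> are the
      energy errors before and after the sweep.\<close>
    from contraction_from_decrease[OF \<mu> S decrease this]
    show ?thesis
      by (simp add: power_mult_distrib)
  qed
qed

text \<open>The sweep estimate applies only from points of the sublevel set; its monotonicity part
  keeps every iterate there by induction.\<close>

lemma fasd_iterates_contraction: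
  assumes it: "fasd_iterates N V Q E E' G' u0 u"
    and sweep: "\<And>x y. E x \<le> E u0 \<Longrightarrow> fasd N V Q E E' G' x y \<Longrightarrow>
      E y \<le> E x \<and> E y - E umin \<le> \<rho> * (E x - E umin)"
  shows "E (u (Suc k)) - E umin \<le> \<rho> * (E (u k) - E umin)"
proof -
  have step: "fasd N V Q E E' G' (u k) (u (Suc k))" for k
    using it by (simp add: fasd_iterates_def)
  have "E (u k) \<le> E u0"
  proof (induction k)
    case (Suc k)
    then show ?case
      using sweep[OF Suc step] by linarith
  qed (use it in \<open>simp add: fasd_iterates_def\<close>)
  then show ?thesis
    using sweep step by blast
qed

section \<open>Quadratic local energies\<close>

text \<open>Only the values of \<open>G' v\<close> on \<open>S\<close> are determined by the derivative within \<open>S\<close>.\<close>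

lemma quadratic_local_energy_deriv:
  assumes "frechet_deriv_on S (quadratic_local_energy Q i x) G'" "subspace S" "v \<in> S" "w \<in> S"
  shows "blinfun_apply (G' v) w = (v - Q i x) \<bullet> w"
proof -
  define c where "c = v - Q i x"
  have "((\<lambda>a. quadratic_local_energy Q i x (v + a *\<^sub>R w)) has_real_derivative blinfun_apply (G' v) w) (at 0)"
    using frechet_deriv_on_line[OF assms, of 0] by simp
  \<comment> \<open>Along the line the energy is a quadratic polynomial in \<open>a\<close>, whose
    linear coefficient must be the derivative at \<open>0\<close>.\<close>
  moreover have "(\<lambda>a. quadratic_local_energy Q i x (v + a *\<^sub>R w))
      = (\<lambda>a. 1 / 2 * (c \<bullet> c) + a * (c \<bullet> w) + a\<^sup>2 / 2 * (w \<bullet> w))"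
    by (rule ext, simp only: quadratic_local_energy_def power2_norm_eq_inner c_def)
      (simp add: inner_simps inner_commute algebra_simps power2_eq_square)
  moreover have "((\<lambda>a. 1 / 2 * (c \<bullet> c) + a * (c \<bullet> w) + a\<^sup>2 / 2 * (w \<bullet> w)) has_real_derivative c \<bullet> w) (at 0)"
    by (auto intro!: derivative_eq_intros)
  ultimately show ?thesis
    unfolding c_def by (metis DERIV_unique)
qed

text \<open>On \<open>S\<close>, \<open>G' w - G' v\<close> is the inner product with
  \<open>w - v\<close>, so both local constants are \<open>1\<close>.\<close>

lemma quadratic_local_energy_regular:
  assumes "frechet_deriv_on S (quadratic_local_energy Q i x) G'" "subspace S"
  shows "strongly_convex_deriv_on S G' 1"
    and "\<And>v w. v \<in> S \<Longrightarrow> w \<in> S \<Longrightarrow> dual_norm_on S (G' w - G' v) \<le> norm (w - v)"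
proof -
  have diff: "blinfun_apply (G' w - G' v) z = (w - v) \<bullet> z" if "v \<in> S" "w \<in> S" "z \<in> S" for v w z
    using quadratic_local_energy_deriv[OF assms] that by (simp add: blinfun.diff_left inner_diff_left)
  show "strongly_convex_deriv_on S G' 1"
    using assms(2) by (simp add: strongly_convex_deriv_on_def diff subspace_diff power2_norm_eq_inner)
  show "dual_norm_on S (G' w - G' v) \<le> norm (w - v)" if "v \<in> S" "w \<in> S" for v w
    using that by (intro dual_norm_on_le) (auto simp: diff norm_cauchy_schwarz)
qed

theorem corollary4p15:
  fixes E :: "'v::{real_inner, complete_space} \<Rightarrow> real"
    and E' :: "'v \<Rightarrow> 'v \<Rightarrow>\<^sub>L real"
    and u0 umin :: 'v
    and N :: nat
    and V :: "nat \<Rightarrow> 'v set"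
    and Q :: "nat \<Rightarrow> 'v \<Rightarrow> 'v"
    and \<mu> L CA CS :: real
  assumes "N \<ge> 1"
    and "frechet_deriv_on UNIV E E'"
    and "strongly_convex_deriv_on UNIV E' \<mu>"
    and "\<forall>v\<in>energy_sublevel E u0. \<forall>w\<in>energy_sublevel E u0. norm (E' w - E' v) \<le> L * norm (w - v)"
    and "is_arg_min E (\<lambda>_. True) umin"
    and "space_decomposition N V"
    and "stable_decomposition N V CA"
    and "strengthened_cauchy_schwarz N V E' (energy_sublevel E u0) CS"
    and "\<forall>i\<in>{1..N}. subspace_projection (V i) (Q i)"
  shows
    "(\<forall>Eloc Eloc' \<mu>loc Lloc u.
        (\<forall>i\<in>{1..N}. frechet_deriv_on (V i) (Eloc i) (Eloc' i)) \<longrightarrow>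
        (\<forall>i\<in>{1..N}. strongly_convex_deriv_on (V i) (Eloc' i) (\<mu>loc i)) \<longrightarrow>
        (\<forall>i\<in>{1..N}. Lloc i > 0 \<and>
           (let Bi = Q i ` enlarged_set (energy_sublevel E u0)
                              (enlargement_radius_sq N L \<mu> \<mu>loc E u0 umin)
            in \<forall>v\<in>Bi. \<forall>w\<in>Bi.
                 dual_norm_on (V i) (Eloc' i w - Eloc' i v) \<le> Lloc i * norm (w - v))) \<longrightarrow>
        fasd_iterates N V Q E E' (\<lambda>i x. Eloc' i) u0 u \<longrightarrow>
        (\<forall>k. E (u (Suc k)) - E umin
               \<le> (let K = CS + L * (1 + Max ((\<lambda>i. Lloc i / \<mu>loc i) ` {1..N}))
                  in CA\<^sup>2 * K\<^sup>2 / (CA\<^sup>2 * K\<^sup>2 + \<mu>\<^sup>2))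
                 * (E (u k) - E umin)))
     \<and>
     (\<forall>G' u.
        (\<forall>i\<in>{1..N}. \<forall>x. frechet_deriv_on (V i) (quadratic_local_energy Q i x) (G' i x)) \<longrightarrow>
        fasd_iterates N V Q E E' G' u0 u \<longrightarrow>
        (\<forall>k. E (u (Suc k)) - E umin
               \<le> CA\<^sup>2 * (CS + 2 * L)\<^sup>2 / (CA\<^sup>2 * (CS + 2 * L)\<^sup>2 + \<mu>\<^sup>2) * (E (u k) - E umin)))"
proof (intro conjI allI impI)
  note sweep = fasd_sweep_contraction[OF assms]
  {
    fix Eloc :: "nat \<Rightarrow> 'v \<Rightarrow> real" and Eloc' \<mu>loc Lloc u k
    assume scl: "\<forall>i\<in>{1..N}. strongly_convex_deriv_on (V i) (Eloc' i) (\<mu>loc i)"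
      and lipl: "\<forall>i\<in>{1..N}. Lloc i > 0 \<and>
           (let Bi = Q i ` enlarged_set (energy_sublevel E u0)
                              (enlargement_radius_sq N L \<mu> \<mu>loc E u0 umin)
            in \<forall>v\<in>Bi. \<forall>w\<in>Bi.
                 dual_norm_on (V i) (Eloc' i w - Eloc' i v) \<le> Lloc i * norm (w - v))"
      and it: "fasd_iterates N V Q E E' (\<lambda>i x. Eloc' i) u0 u"
    have scl': "\<forall>i\<in>{1..N}. \<forall>x. strongly_convex_deriv_on (V i) (Eloc' i) (\<mu>loc i)"
      and l: "\<forall>i\<in>{1..N}. Lloc i > 0"
      and lipl': "\<forall>i\<in>{1..N}. \<forall>x.
        \<forall>v\<in>Q i ` enlarged_set (energy_sublevel E u0) (enlargement_radius_sq N L \<mu> \<mu>loc E u0 umin).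
        \<forall>w\<in>Q i ` enlarged_set (energy_sublevel E u0) (enlargement_radius_sq N L \<mu> \<mu>loc E u0 umin).
          dual_norm_on (V i) (Eloc' i w - Eloc' i v) \<le> Lloc i * norm (w - v)"
      using scl lipl by (simp_all add: Let_def)
    show "E (u (Suc k)) - E umin
               \<le> (let K = CS + L * (1 + Max ((\<lambda>i. Lloc i / \<mu>loc i) ` {1..N}))
                  in CA\<^sup>2 * K\<^sup>2 / (CA\<^sup>2 * K\<^sup>2 + \<mu>\<^sup>2))
                 * (E (u k) - E umin)"
      unfolding Let_def
      by (rule fasd_iterates_contraction[OF it])
        (use sweep[where G' = "\<lambda>i x. Eloc' i", OF scl' l lipl' _ _ refl] in blast)
  next
    fix G' u k
    assume G': "\<forall>i\<in>{1..N}. \<forall>x. frechet_deriv_on (V i) (quadratic_local_energy Q i x) (G' i x)"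
      and it: "fasd_iterates N V Q E E' G' u0 u"
    have sub: "\<forall>i\<in>{1..N}. subspace (V i)"
      using assms(6) by (simp add: space_decomposition_def)
    have Q_in: "\<forall>i\<in>{1..N}. \<forall>x. Q i x \<in> V i"
      using assms(9) by (simp add: subspace_projection_def)
    have scl: "\<forall>i\<in>{1..N}. \<forall>x. strongly_convex_deriv_on (V i) (G' i x) 1"
      using quadratic_local_energy_regular(1) G' sub by blast
    \<comment> \<open>The Lipschitz bound holds on all of \<open>V i\<close>, which contains every
      projected set; hence \<open>B\<close> is arbitrary.\<close>
    have lipl: "\<forall>i\<in>{1..N}. \<forall>x. \<forall>v\<in>Q i ` B. \<forall>w\<in>Q i ` B.
        dual_norm_on (V i) (G' i x w - G' i x v) \<le> 1 * norm (w - v)" for B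
    proof (intro ballI allI)
      fix i x v w assume "i \<in> {1..N}" "v \<in> Q i ` B" "w \<in> Q i ` B"
      then show "dual_norm_on (V i) (G' i x w - G' i x v) \<le> 1 * norm (w - v)"
        using quadratic_local_energy_regular(2)[of "V i" Q i x "G' i x"] G' sub Q_in by auto
    qed
    \<comment> \<open>The index set is nonempty, so the maximum is \<open>1\<close> and the factor
      of \<open>L\<close> becomes \<open>1 + 1\<close>.\<close>
    have K: "CS + 2 * L = CS + L * (1 + Max ((\<lambda>i. 1 / 1) ` {1..N}))"
      using assms(1) by (simp add: image_constant_conv)
    show "E (u (Suc k)) - E umin
               \<le> CA\<^sup>2 * (CS + 2 * L)\<^sup>2 / (CA\<^sup>2 * (CS + 2 * L)\<^sup>2 + \<mu>\<^sup>2) * (E (u k) - E umin)"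
      by (rule fasd_iterates_contraction[OF it])
        (use sweep[where G' = G', OF scl _ lipl _ _ K] in simp)
  }
qed

end
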